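(* Let $X$ and $Y$ be two non-empty convex subsets of Hausdorff topological vector spaces, and let $A,B\subseteq X\times Y$ with $A\in\mathcal{N}(X,Y)$ and $B\in\mathcal{N}^{-1}(X,Y)$. Suppose that at least one of the following compactness conditions holds: (i) $Y$ is compact; or (ii) $X$ is compact; or (iii) there exist a compact subset $K$ of $X$ and a compact convex subset $C$ of $Y$ such that $A(x)\cap C\neq\emptyset$ for all $x\in X\setminus K$. Then $A\cap B\neq\emptyset$.
   Context: Vector spaces are real (or complex). For a subset $A\subseteq X\times Y$, write $A(x)=\{y\in Y:(x,y)\in A\}$ for $x\in X$, $A^{-1}(y)=\{x\in X:(x,y)\in A\}$ for $y\in Y$, and $A^{-1}=\{(y,x):(x,y)\in A\}\subseteq Y\times X$. For subsets $X,Y$ of topological vector spaces, a von Neumann relation is a subset $A\subseteq X\times Y$ such that: (1) for every $x\in X$, the section $A(x)$ is convex and non-empty; (2) for every $y\in Y$, the section $A^{-1}(y)$ is open in $X$ and $X\setminus A^{-1}(y)$ is convex. The class of von Neumann relations in $X\times Y$ is denoted $\mathcal{N}(X,Y)$, and $\mathcal{N}^{-1}(X,Y)$ denotes the class of $B\subseteq X\times Y$ with $B^{-1}\in\mathcal{N}(Y,X)$; that is, for every $y\in Y$ the section $B^{-1}(y)$ is convex and non-empty, and for every $x\in X$ the section $B(x)$ is open in $Y$ and $Y\setminus B(x)$ is convex. *)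

theory Defs
  imports "HOL-Analysis.Analysis"
begin

text \<open>
  Real topological vector spaces, not assumed Hausdorff; the Hausdorff property is added by the
  class \<open>t2_space\<close>. Joint continuity of scalar multiplication is stated pointwise, in the style
  of \<open>topological_monoid_add\<close>.
\<close>

class topological_real_vector = real_vector + topological_ab_group_add +
  assumes tendsto_scaleR_Pair:
    "((\<lambda>p. fst p *\<^sub>R snd p) \<longlongrightarrow> c *\<^sub>R x) (nhds c \<times>\<^sub>F nhds x)"

instance real_normed_vector \<subseteq> topological_real_vector
proof
  fix c :: real and x :: 'a
  show "((\<lambda>p. fst p *\<^sub>R snd p) \<longlongrightarrow> c *\<^sub>R x) (nhds c \<times>\<^sub>F nhds x)"
    by (intro tendsto_scaleR filterlim_fst filterlim_snd)
qed

text \<open>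
  The section of a relation \<open>A\<close> at \<open>x\<close> is \<open>A `` {x}\<close>; its section at \<open>y\<close> in the second
  coordinate is \<open>A\<inverse> `` {y}\<close>.
\<close>

definition von_neumann_relations ::
    "'a::{real_vector,topological_space} set \<Rightarrow> 'b::{real_vector,topological_space} set
      \<Rightarrow> ('a \<times> 'b) set set"
  where "von_neumann_relations X Y = {A. A \<subseteq> X \<times> Y \<and>
    (\<forall>x\<in>X. convex (A `` {x}) \<and> A `` {x} \<noteq> {}) \<and>
    (\<forall>y\<in>Y. openin (top_of_set X) (A\<inverse> `` {y}) \<and> convex (X - A\<inverse> `` {y}))}"

definition inverse_von_neumann_relations ::
    "'a::{real_vector,topological_space} set \<Rightarrow> 'b::{real_vector,topological_space} set
      \<Rightarrow> ('a \<times> 'b) set set"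
  where "inverse_von_neumann_relations X Y =
    {B. B \<subseteq> X \<times> Y \<and> B\<inverse> \<in> von_neumann_relations Y X}"

end

theory Submission
  imports Defs
begin

text \<open>
  The compactness conditions (i) and (ii) are instances of (iii), with \<open>K = {}\<close>, \<open>C = Y\<close> and with
  \<open>K = X\<close>, \<open>C = {}\<close>. Under (iii), finitely many points of \<open>Y\<close> handle \<open>K\<close>; adding them to \<open>C\<close> gives
  a compact convex \<open>D \<subseteq> Y\<close> that meets every section \<open>A `` {x}\<close>. Finitely many \<open>B `` {x j}\<close> cover
  \<open>D\<close>, and finitely many \<open>A\<inverse> `` {y i}\<close> with \<open>y i \<in> D\<close> cover the convex hull of the \<open>x j\<close>. On the
  simplices of weights, partitions of unity subordinate to these covers give continuous maps \<open>p\<close>, \<open>q\<close>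
  that select points of the convex sections of \<open>A\<close> and of \<open>B\<inverse>\<close>, and a Brouwer fixed point of
  \<open>q \<circ> p\<close> yields a point of \<open>A \<inter> B\<close>.
\<close>

section \<open>Brouwer's theorem in term-indexed dimension\<close>

lemma tendsto_fun_iff:
  fixes f :: "'c \<Rightarrow> 'i \<Rightarrow> 'd::topological_space"
  shows "(f \<longlongrightarrow> l) F \<longleftrightarrow> (\<forall>i. ((\<lambda>x. f x i) \<longlongrightarrow> l i) F)"
  using limitin_componentwise[of "\<lambda>_::'i. euclidean :: 'd topology" UNIV f l F]
  by (simp add: euclidean_product_topology)

text \<open>The bound \<open>n\<close> is a term, so the \<open>n\<close>-cube sits inside
  \<open>nat \<Rightarrow> real\<close> with all further coordinates pinned to 0. As a product of
  compact factors it is compact by Tychonoff.\<close>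

definition unit_cube :: "nat \<Rightarrow> (nat \<Rightarrow> real) set"
  where "unit_cube n = (\<Pi>\<^sub>E i\<in>UNIV. if i < n then {0..1} else {0})"

lemma unit_cube_iff:
  "x \<in> unit_cube n \<longleftrightarrow> (\<forall>i<n. 0 \<le> x i \<and> x i \<le> 1) \<and> (\<forall>i\<ge>n. x i = 0)"
  by (auto simp: unit_cube_def PiE_iff not_less split: if_splits)

lemma compact_unit_cube: "compact (unit_cube n)"
proof -
  have "compactin (product_topology (\<lambda>_. euclidean) UNIV) (unit_cube n)"
    unfolding unit_cube_def compactin_PiE by auto
  then show ?thesis
    by (simp add: euclidean_product_topology)
qed

text \<open>
  Kuhn's labelling lemma applied to finer and finer grids. The library proves Brouwer's theorem
  only for types of class \<open>euclidean_space\<close>, whose dimension cannot depend on a term.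
\<close>

lemma brouwer_unit_cube:
  assumes f: "continuous_on (unit_cube n) f" "f ` unit_cube n \<subseteq> unit_cube n"
  obtains x where "x \<in> unit_cube n" "f x = x"
proof -
  define pt where "pt p x = (\<lambda>i. if i < n then real (x i) / real p else 0)" for p and x :: "nat \<Rightarrow> nat"
  \<comment> \<open>Label 0 records that \<open>f\<close> does not decrease coordinate
    \<open>i\<close>. The clause \<open>x i < p\<close> forces label 1 on the top face, even where
    \<open>f\<close> fixes the coordinate, as Kuhn's lemma demands; on the bottom face label 0 is
    automatic since \<open>f\<close> is nonnegative.\<close>
  define label where
    "label p x i = (if x i < p \<and> pt p x i \<le> f (pt p x) i then 0 else 1::nat)" for p x i
  have pt_cube: "pt p x \<in> unit_cube n" if "p > 0" "\<forall>i<n. x i \<le> p" for p x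
    using that by (auto simp: unit_cube_iff pt_def)
  have f_cube: "0 \<le> f x i" "f x i \<le> 1" if "x \<in> unit_cube n" "i < n" for x i
    using f(2) that by (auto simp: unit_cube_iff image_subset_iff)
  have below: "pt p x i \<le> f (pt p x) i" if "label p x i = 0" for p x i
    using that by (auto simp: label_def split: if_splits)
  \<comment> \<open>On the top face, where label 1 is imposed, the inequality still holds because
    \<open>f\<close> is at most 1 there.\<close>
  have above: "f (pt p x) i \<le> pt p x i"
    if "label p x i \<noteq> 0" "p > 0" "\<forall>i<n. x i \<le> p" "i < n" for p x i
  proof (cases "x i < p")
    case True
    then show ?thesis using that by (auto simp: label_def split: if_splits)
  next
    case False
    then have "pt p x i = 1" using that by (auto simp: pt_def intro: antisym)
    then show ?thesis using f_cube(2)[OF pt_cube] that by metis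
  qed
  \<comment> \<open>\<open>z\<close> is the corner of a grid cell of mesh \<open>1 / Suc p\<close>;
    the successor keeps the mesh positive and finite for every \<open>p\<close>. The vertices
    \<open>u\<close> and \<open>v\<close> may differ from one coordinate \<open>i\<close> to the
    next.\<close>
  have "\<exists>z\<in>unit_cube n. \<forall>i<n. \<exists>u\<in>unit_cube n. \<exists>v\<in>unit_cube n.
      (\<forall>j. \<bar>u j - z j\<bar> \<le> 1 / real (Suc p)) \<and> (\<forall>j. \<bar>v j - z j\<bar> \<le> 1 / real (Suc p)) \<and>
      u i \<le> f u i \<and> f v i \<le> v i" for p
  proof -
    let ?p = "Suc p"
    have lab0: "label ?p x i = 0" if "\<forall>i<n. x i \<le> ?p" "i < n" "x i = 0" for x i
      using f_cube(1)[OF pt_cube[of ?p x]] that by (simp add: label_def pt_def)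
    have "\<forall>x. (\<forall>i<n. x i \<le> ?p) \<longrightarrow> (\<forall>i<n. label ?p x i = 0 \<or> label ?p x i = 1)"
      by (simp add: label_def)
    moreover have "\<forall>x. (\<forall>i<n. x i \<le> ?p) \<longrightarrow> (\<forall>i<n. x i = 0 \<longrightarrow> label ?p x i = 0)"
      using lab0 by blast
    moreover have "\<forall>x. (\<forall>i<n. x i \<le> ?p) \<longrightarrow> (\<forall>i<n. x i = ?p \<longrightarrow> label ?p x i = 1)"
      by (simp add: label_def)
    ultimately obtain q where q: "\<forall>i<n. q i < ?p"
      and rs: "\<forall>i<n. \<exists>r s. (\<forall>j<n. q j \<le> r j \<and> r j \<le> q j + 1) \<and>
        (\<forall>j<n. q j \<le> s j \<and> s j \<le> q j + 1) \<and> label ?p r i \<noteq> label ?p s i"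
      by (rule kuhn_lemma[OF zero_less_Suc])
    have close: "\<bar>pt ?p r j - pt ?p q j\<bar> \<le> 1 / real ?p"
      if "\<forall>j<n. q j \<le> r j \<and> r j \<le> q j + 1" for r j
    proof (cases "j < n")
      case True
      then have "\<bar>real (r j) - real (q j)\<bar> \<le> 1" using that by auto
      moreover have "pt ?p r j - pt ?p q j = (real (r j) - real (q j)) / real ?p"
        using True by (simp add: pt_def diff_divide_distrib)
      ultimately show ?thesis
        by (simp only: abs_divide abs_of_nat divide_right_mono of_nat_0_le_iff)
    qed (simp add: pt_def)
    \<comment> \<open>Since \<open>q j\<close> is strictly below \<open>?p\<close>, the far vertices
      of the cell, with coordinates up to \<open>q j + 1\<close>, remain on the grid.\<close>
    have grid: "pt ?p r \<in> unit_cube n" "\<forall>j<n. r j \<le> ?p"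
      if "\<forall>j<n. q j \<le> r j \<and> r j \<le> q j + 1" for r
    proof -
      show "\<forall>j<n. r j \<le> ?p" using that q by fastforce
      then show "pt ?p r \<in> unit_cube n" by (intro pt_cube) auto
    qed
    show ?thesis
    proof (rule bexI[of _ "pt ?p q"], intro allI impI)
      show "pt ?p q \<in> unit_cube n" by (rule grid) simp
      fix i assume i: "i < n"
      obtain r s where r: "\<forall>j<n. q j \<le> r j \<and> r j \<le> q j + 1"
        and s: "\<forall>j<n. q j \<le> s j \<and> s j \<le> q j + 1" and ne: "label ?p r i \<noteq> label ?p s i"
        using rs i by blast
      \<comment> \<open>Kuhn's lemma only says that two labels differ; the two vertices are swapped
        if necessary.\<close>
      have "\<exists>u v. (\<forall>j<n. q j \<le> u j \<and> u j \<le> q j + 1) \<and> (\<forall>j<n. q j \<le> v j \<and> v j \<le> q j + 1) \<and>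
          label ?p u i = 0 \<and> label ?p v i \<noteq> 0"
      proof (cases "label ?p r i = 0")
        case True
        then show ?thesis using r s ne by metis
      next
        case False
        moreover have "label ?p s i = 0" using ne False by (auto simp: label_def split: if_splits)
        ultimately show ?thesis using r s by blast
      qed
      then obtain u v where u: "\<forall>j<n. q j \<le> u j \<and> u j \<le> q j + 1"
        and v: "\<forall>j<n. q j \<le> v j \<and> v j \<le> q j + 1"
        and "label ?p u i = 0" "label ?p v i \<noteq> 0"
        by blast
      then have "pt ?p u i \<le> f (pt ?p u) i" "f (pt ?p v) i \<le> pt ?p v i"
        using below above[OF _ _ grid(2)[OF v] i] by auto
      then show "\<exists>u\<in>unit_cube n. \<exists>v\<in>unit_cube n.
          (\<forall>j. \<bar>u j - pt ?p q j\<bar> \<le> 1 / real ?p) \<and> (\<forall>j. \<bar>v j - pt ?p q j\<bar> \<le> 1 / real ?p) \<and>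
          u i \<le> f u i \<and> f v i \<le> v i"
        using grid(1)[OF u] grid(1)[OF v] close[OF u] close[OF v] by blast
    qed
  qed
  then obtain z where z: "\<And>p. z p \<in> unit_cube n"
    and z_uv: "\<And>p. \<forall>i<n. \<exists>u\<in>unit_cube n. \<exists>v\<in>unit_cube n.
      (\<forall>j. \<bar>u j - z p j\<bar> \<le> 1 / real (Suc p)) \<and> (\<forall>j. \<bar>v j - z p j\<bar> \<le> 1 / real (Suc p)) \<and>
      u i \<le> f u i \<and> f v i \<le> v i"
    by metis
  \<comment> \<open>Moving the guard \<open>i < n\<close> under the existential quantifiers makes
    the choice functions total in \<open>p\<close> and \<open>i\<close>.\<close>
  have "\<forall>p i. \<exists>u v. i < n \<longrightarrow> u \<in> unit_cube n \<and> v \<in> unit_cube n \<and>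
      (\<forall>j. \<bar>u j - z p j\<bar> \<le> 1 / real (Suc p)) \<and> (\<forall>j. \<bar>v j - z p j\<bar> \<le> 1 / real (Suc p)) \<and>
      u i \<le> f u i \<and> f v i \<le> v i"
    using z_uv by blast
  then obtain u v where "\<forall>p i. i < n \<longrightarrow> u p i \<in> unit_cube n \<and> v p i \<in> unit_cube n \<and>
      (\<forall>j. \<bar>u p i j - z p j\<bar> \<le> 1 / real (Suc p)) \<and>
      (\<forall>j. \<bar>v p i j - z p j\<bar> \<le> 1 / real (Suc p)) \<and>
      u p i i \<le> f (u p i) i \<and> f (v p i) i \<le> v p i i"
    unfolding choice_iff by blast
  then have uv: "u p i \<in> unit_cube n" "v p i \<in> unit_cube n"
    "\<bar>u p i j - z p j\<bar> \<le> 1 / real (Suc p)" "\<bar>v p i j - z p j\<bar> \<le> 1 / real (Suc p)"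
    "u p i i \<le> f (u p i) i" "f (v p i) i \<le> v p i i"
    if "i < n" for p i j
    using that by auto
  obtain l r where l: "l \<in> unit_cube n" and r: "strict_mono r" and lim: "(z \<circ> r) \<longlonglongrightarrow> l"
    using compact_unit_cube[of n] z unfolding compact_def by metis
  \<comment> \<open>Any sequence of points within the mesh of \<open>z\<close> has the same
    subsequential limit \<open>l\<close>. This will be applied to \<open>u\<close> and
    \<open>v\<close> for each fixed coordinate.\<close>
  have lim_near: "(\<lambda>k. w (r k)) \<longlonglongrightarrow> l" "(\<lambda>k. f (w (r k))) \<longlonglongrightarrow> f l"
    if "\<And>p. w p \<in> unit_cube n" "\<And>p j. \<bar>w p j - z p j\<bar> \<le> 1 / real (Suc p)" for w
  proof -
    have "(\<lambda>k. w (r k) j) \<longlonglongrightarrow> l j" for j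
    proof -
      have "(\<lambda>p. w p j - z p j) \<longlonglongrightarrow> 0"
        by (rule Lim_null_comparison[OF _ lim_1_over_n[THEN LIMSEQ_Suc]])
          (use that(2) in \<open>auto simp: eventually_sequentially\<close>)
      then have "(\<lambda>k. w (r k) j - z (r k) j) \<longlonglongrightarrow> 0"
        using LIMSEQ_subseq_LIMSEQ[OF _ r] by (fastforce simp: o_def)
      moreover have "(\<lambda>k. z (r k) j) \<longlonglongrightarrow> l j"
        using lim by (simp add: tendsto_fun_iff o_def)
      ultimately show ?thesis
        using tendsto_add by fastforce
    qed
    then show 1: "(\<lambda>k. w (r k)) \<longlonglongrightarrow> l" by (simp add: tendsto_fun_iff)
    show "(\<lambda>k. f (w (r k))) \<longlonglongrightarrow> f l"
      using continuous_on_tendsto_compose[OF f(1) 1 l] that(1) by simp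
  qed
  have "f l i = l i" if i: "i < n" for i
  proof (rule antisym)
    show "f l i \<le> l i"
      by (rule LIMSEQ_le[of "\<lambda>k. f (v (r k) i) i" _ "\<lambda>k. v (r k) i i"])
        (use lim_near[of "\<lambda>p. v p i"] uv i in \<open>auto simp: tendsto_fun_iff\<close>)
    show "l i \<le> f l i"
      by (rule LIMSEQ_le[of "\<lambda>k. u (r k) i i" _ "\<lambda>k. f (u (r k) i) i"])
        (use lim_near[of "\<lambda>p. u p i"] uv i in \<open>auto simp: tendsto_fun_iff\<close>)
  qed
  moreover have "f l i = l i" if "i \<ge> n" for i
    using f(2) l that by (auto simp: unit_cube_iff image_subset_iff)
  ultimately have "f l = l" by (metis ext not_le)
  with l that show thesis by blast
qed

text \<open>This is the standard simplex with \<open>n\<close> vertices, hence of dimension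
  \<open>n - 1\<close>, and it is empty for \<open>n = 0\<close>. Its points serve as coefficient
  vectors of convex combinations.\<close>

definition weight_simplex :: "nat \<Rightarrow> (nat \<Rightarrow> real) set"
  where "weight_simplex n = {s. (\<forall>i. 0 \<le> s i) \<and> (\<forall>i\<ge>n. s i = 0) \<and> (\<Sum>i<n. s i) = 1}"

lemma weight_simplex_support: "s \<in> weight_simplex n \<Longrightarrow> s i \<noteq> 0 \<Longrightarrow> i < n"
  by (auto simp: weight_simplex_def not_le[symmetric])

lemma weight_simplex_subset_cube: "weight_simplex n \<subseteq> unit_cube n"
proof
  fix s assume s: "s \<in> weight_simplex n"
  have "s i \<le> 1" if "i < n" for i
    using member_le_sum[of i "{..<n}" s] s that by (auto simp: weight_simplex_def)
  then show "s \<in> unit_cube n" using s by (auto simp: weight_simplex_def unit_cube_iff)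
qed

lemma compact_weight_simplex: "compact (weight_simplex n)"
proof -
  have "closed {s::nat \<Rightarrow> real. \<forall>i. 0 \<le> s i}"
    by (intro closed_Collect_all closed_Collect_le continuous_intros continuous_on_product_coordinates)
  moreover have "closed {s::nat \<Rightarrow> real. (\<Sum>i<n. s i) = 1}"
    by (intro closed_Collect_eq continuous_intros continuous_on_product_coordinates)
  ultimately have "compact (unit_cube n \<inter> ({s. \<forall>i. 0 \<le> s i} \<inter> {s. (\<Sum>i<n. s i) = 1}))"
    by (intro compact_Int_closed compact_unit_cube closed_Int)
  also have "unit_cube n \<inter> ({s. \<forall>i. 0 \<le> s i} \<inter> {s. (\<Sum>i<n. s i) = 1}) = weight_simplex n"
    using weight_simplex_subset_cube by (auto simp: weight_simplex_def unit_cube_iff)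
  finally show ?thesis .
qed

text \<open>
  The cube retracts onto the simplex by adding the missing mass \<open>max 0 (1 - \<Sum>i<n. x i)\<close> to
  coordinate \<open>0\<close> and then normalizing.
\<close>

lemma brouwer_weight_simplex:
  assumes n: "0 < n" and f: "continuous_on (weight_simplex n) f"
    "f ` weight_simplex n \<subseteq> weight_simplex n"
  obtains s where "s \<in> weight_simplex n" "f s = s"
proof -
  define d where "d x = max 0 (1 - (\<Sum>i<n. x i))" for x :: "nat \<Rightarrow> real"
  define N where "N x = (\<Sum>i<n. x i) + d x" for x :: "nat \<Rightarrow> real"
  define R where "R x = (\<lambda>i. (x i + (if i = 0 then d x else 0)) / N x)" for x :: "nat \<Rightarrow> real"
  \<comment> \<open>\<open>N x\<close> is the maximum of 1 and the coordinate sum, so the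
    normalization in \<open>R\<close> is continuous on the whole space.\<close>
  have N: "N x \<ge> 1" for x by (auto simp: N_def d_def)
  have R: "R x \<in> weight_simplex n" if "x \<in> unit_cube n" for x
  proof -
    have "0 \<le> x i" for i using that by (cases "i < n") (auto simp: unit_cube_iff)
    moreover have "d x \<ge> 0" by (simp add: d_def)
    moreover have "(\<Sum>i<n. x i + (if i = 0 then d x else 0)) = N x"
      using n by (simp add: sum.distrib N_def sum.delta)
    ultimately show ?thesis
      using that n N[of x]
      by (auto simp: weight_simplex_def unit_cube_iff R_def simp flip: sum_divide_distrib)
  qed
  have R_id: "R x = x" if "x \<in> weight_simplex n" for x
    using that by (auto simp: weight_simplex_def R_def N_def d_def)
  have N0: "N x \<noteq> 0" for x using N[of x] by linarith
  have "continuous_on UNIV R"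
  proof (rule continuous_on_coordinatewise_then_product)
    have d: "continuous_on UNIV d" unfolding d_def
      by (intro continuous_intros continuous_on_product_coordinates)
    then have "continuous_on UNIV N" unfolding N_def
      by (intro continuous_intros continuous_on_product_coordinates)
    with d show "continuous_on UNIV (\<lambda>x. R x i)" for i
      unfolding R_def using N0
      by (cases "i = 0") (auto intro!: continuous_intros continuous_on_product_coordinates)
  qed
  then have cR: "continuous_on (unit_cube n) R" by (rule continuous_on_subset) simp
  have "continuous_on (unit_cube n) (f \<circ> R)"
    by (rule continuous_on_compose[OF cR continuous_on_subset[OF f(1)]]) (use R in auto)
  moreover have "(f \<circ> R) ` unit_cube n \<subseteq> unit_cube n"
    using R f(2) weight_simplex_subset_cube by fastforce
  ultimately obtain x where x: "x \<in> unit_cube n" "f (R x) = x"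
    by (auto elim: brouwer_unit_cube)
  \<comment> \<open>A fixed point of \<open>f \<circ> R\<close> is a value of \<open>f\<close>, so
    it already lies in the simplex, where \<open>R\<close> is the identity.\<close>
  then have "x \<in> weight_simplex n" using R f(2) by (metis image_subset_iff)
  then show thesis using that x(2) R_id by simp
qed

section \<open>Partitions of unity and selections\<close>

text \<open>In a metric space the distance to the complement of \<open>U i\<close> is continuous and
  positive exactly on \<open>U i\<close>; dividing by the sum, which is positive by the covering,
  gives the weights.\<close>

lemma finite_partition_of_unity:
  fixes S :: "'m::metric_space set" and U :: "nat \<Rightarrow> 'm set"
  assumes U: "\<And>i. i < n \<Longrightarrow> openin (top_of_set S) (U i)" and cover: "S \<subseteq> (\<Union>i<n. U i)"
  obtains w where "continuous_on S w" "w ` S \<subseteq> weight_simplex n"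
    "\<forall>s\<in>S. \<forall>i. w s i \<noteq> 0 \<longrightarrow> i < n \<and> s \<in> U i"
proof -
  \<comment> \<open>The distance to the empty set is 0 by convention, so a set \<open>U i\<close>
    that contains all of \<open>S\<close> gets the constant 1 instead.\<close>
  define b where
    "b i s = (if i < n then if S \<subseteq> U i then 1 else infdist s (S - U i) else 0)" for i s
  have b_cont: "continuous_on S (b i)" for i
    unfolding b_def by (cases "i < n"; cases "S \<subseteq> U i") (auto intro!: continuous_intros)
  have b_nonneg: "0 \<le> b i s" for i s by (auto simp: b_def infdist_nonneg)
  have b_pos: "b i s > 0 \<longleftrightarrow> s \<in> U i" if "i < n" "s \<in> S" for i s
  proof (cases "S \<subseteq> U i")
    case False
    obtain T where T: "open T" "U i = S \<inter> T" using U[OF \<open>i < n\<close>] by (auto simp: openin_open)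
    have "infdist s (S - U i) > 0" if "s \<in> U i"
    proof -
      have "s \<notin> closure (S - U i)"
        using T that by (auto simp: closure_iff_nhds_not_empty)
      then show ?thesis
        using False in_closure_iff_infdist_zero[of "S - U i" s] infdist_nonneg[of s "S - U i"]
        by (auto simp: less_le)
    qed
    moreover have "infdist s (S - U i) = 0" if "s \<notin> U i"
      using that \<open>s \<in> S\<close> by simp
    ultimately show ?thesis using that False by (cases "s \<in> U i") (auto simp: b_def)
  qed (use that in \<open>auto simp: b_def\<close>)
  define w where "w s = (\<lambda>i. b i s / (\<Sum>j<n. b j s))" for s
  have pos: "(\<Sum>j<n. b j s) > 0" if s: "s \<in> S" for s
  proof -
    obtain i where "i < n" "s \<in> U i" using cover s by auto
    then show ?thesis using b_pos[OF _ s] b_nonneg by (intro sum_pos2[of _ i]) auto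
  qed
  show thesis
  proof
    show "continuous_on S w"
    proof (rule continuous_on_coordinatewise_then_product)
      show "continuous_on S (\<lambda>s. w s i)" for i
        unfolding w_def using pos by (intro continuous_intros b_cont) fastforce
    qed
    show "w ` S \<subseteq> weight_simplex n"
    proof safe
      fix s assume s: "s \<in> S"
      have "(\<Sum>i<n. w s i) = 1"
        using pos[OF s] by (simp add: w_def flip: sum_divide_distrib)
      moreover have "w s i = 0" if "i \<ge> n" for i using that by (simp add: w_def b_def)
      ultimately show "w s \<in> weight_simplex n"
        by (simp add: weight_simplex_def) (simp add: w_def b_nonneg sum_nonneg)
    qed
    have "i < n \<and> s \<in> U i" if s: "s \<in> S" and "w s i \<noteq> 0" for s i
    proof -
      have "b i s \<noteq> 0" using that by (auto simp: w_def)
      moreover from this have "i < n" by (auto simp: b_def split: if_splits)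
      ultimately show ?thesis using b_pos[OF _ s] b_nonneg[of i s] by force
    qed
    then show "\<forall>s\<in>S. \<forall>i. w s i \<noteq> 0 \<longrightarrow> i < n \<and> s \<in> U i" by blast
  qed
qed

text \<open>Indices of weight zero contribute nothing, so the sum may be restricted to the support,
  where all points lie in \<open>V\<close>.\<close>

lemma weighted_sum_in_convex:
  assumes w: "w \<in> weight_simplex n" and "convex V" and V: "\<And>i. w i \<noteq> 0 \<Longrightarrow> y i \<in> V"
  shows "(\<Sum>i<n. w i *\<^sub>R y i) \<in> V"
proof -
  let ?I = "{i. i < n \<and> w i \<noteq> 0}"
  have "(\<Sum>i\<in>?I. w i) = (\<Sum>i<n. w i)" "(\<Sum>i\<in>?I. w i *\<^sub>R y i) = (\<Sum>i<n. w i *\<^sub>R y i)"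
    by (auto intro: sum.mono_neutral_left)
  moreover from this have "(\<Sum>i\<in>?I. w i *\<^sub>R y i) \<in> V"
    using w by (intro convex_sum V \<open>convex V\<close>) (auto simp: weight_simplex_def)
  ultimately show ?thesis by metis
qed

text \<open>Browder's selection argument: with weights subordinate to the open fibres, only those
  \<open>y i\<close> that belong to \<open>V s\<close> carry weight at \<open>s\<close>, and
  convexity does the rest. The selection is returned as a weight map, so that its values lie in a
  simplex and Brouwer's theorem can be applied.\<close>

lemma continuous_selection:
  fixes S :: "'m::metric_space set" and V :: "'m \<Rightarrow> 'v::real_vector set"
  assumes "\<And>i. i < n \<Longrightarrow> openin (top_of_set S) {s \<in> S. y i \<in> V s}"
    and "\<And>s. s \<in> S \<Longrightarrow> convex (V s)" and "\<And>s. s \<in> S \<Longrightarrow> \<exists>i<n. y i \<in> V s"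
  obtains w where "continuous_on S w" "w ` S \<subseteq> weight_simplex n"
    "\<And>s. s \<in> S \<Longrightarrow> (\<Sum>i<n. w s i *\<^sub>R y i) \<in> V s"
proof -
  have "S \<subseteq> (\<Union>i<n. {s \<in> S. y i \<in> V s})" using assms(3) by blast
  with assms(1) obtain w where w: "continuous_on S w" "w ` S \<subseteq> weight_simplex n"
    "\<forall>s\<in>S. \<forall>i. w s i \<noteq> 0 \<longrightarrow> i < n \<and> s \<in> {s \<in> S. y i \<in> V s}"
    by (rule finite_partition_of_unity)
  show thesis
    by (rule that[OF w(1,2)], rule weighted_sum_in_convex) (use w assms in auto)
qed

section \<open>Compactness in topological vector spaces\<close>

lemma continuous_on_scaleR_topological:
  fixes g :: "'c::topological_space \<Rightarrow> 'v::topological_real_vector"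
  assumes "continuous_on S h" "continuous_on S g"
  shows "continuous_on S (\<lambda>x. h x *\<^sub>R g x)"
  unfolding continuous_on_def
proof
  fix x assume "x \<in> S"
  then have "((\<lambda>x. (h x, g x)) \<longlongrightarrow> (h x, g x)) (at x within S)"
    using assms by (intro tendsto_Pair) (auto simp: continuous_on_def)
  then have "filterlim (\<lambda>x. (h x, g x)) (nhds (h x) \<times>\<^sub>F nhds (g x)) (at x within S)"
    by (simp add: nhds_prod)
  from filterlim_compose[OF tendsto_scaleR_Pair this]
  show "((\<lambda>x. h x *\<^sub>R g x) \<longlongrightarrow> h x *\<^sub>R g x) (at x within S)" by simp
qed

lemma continuous_on_weighted_sum:
  fixes y :: "nat \<Rightarrow> 'v::topological_real_vector"
  shows "continuous_on S (\<lambda>w. \<Sum>i<n. w i *\<^sub>R y i)"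
  by (intro continuous_on_sum continuous_on_scaleR_topological continuous_on_const
      continuous_on_subset[OF continuous_on_product_coordinates subset_UNIV])

text \<open>Points are added one at a time. The hull of a nonempty convex set and one more point is
  the union of the segments joining them, which is a continuous image of \<open>{0..1}\<close> times
  the old hull.\<close>

lemma compact_convex_hull_Un_finite:
  fixes C :: "'v::topological_real_vector set"
  assumes "finite F" "compact C" "convex C"
  shows "compact (convex hull (C \<union> F))"
  using assms(1)
proof induction
  case empty
  then show ?case using assms by (simp add: hull_same)
next
  case (insert a F)
  show ?case
  proof (cases "C \<union> F = {}")
    case False
    let ?g = "\<lambda>p. (1 - fst p) *\<^sub>R a + fst p *\<^sub>R snd p"
    have "convex hull (insert a (C \<union> F)) = ?g ` ({0..1} \<times> (convex hull (C \<union> F)))"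
      unfolding convex_hull_insert[OF False]
    proof safe
      fix u v :: real and b
      assume "0 \<le> u" "0 \<le> v" "u + v = 1" and b: "b \<in> convex hull (C \<union> F)"
      then have u: "u = 1 - v" and v: "v \<in> {0..1}" by auto
      show "u *\<^sub>R a + v *\<^sub>R b \<in> ?g ` ({0..1} \<times> (convex hull (C \<union> F)))"
        unfolding u using b v by (intro image_eqI[of _ _ "(v, b)"]) auto
    next
      fix v :: real and b
      assume "v \<in> {0..1}" and b: "b \<in> convex hull (C \<union> F)"
      then show "\<exists>u\<ge>0. \<exists>w\<ge>0. \<exists>c. u + w = 1 \<and> c \<in> convex hull (C \<union> F) \<and>
          (1 - fst (v, b)) *\<^sub>R a + fst (v, b) *\<^sub>R snd (v, b) = u *\<^sub>R a + w *\<^sub>R c"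
        by (intro exI[of _ "1 - v"] exI[of _ v] exI[of _ b] conjI) auto
    qed
    moreover have "compact (?g ` ({0..1} \<times> (convex hull (C \<union> F))))"
      by (intro compact_continuous_image compact_Times insert.IH compact_Icc continuous_intros
          continuous_on_scaleR_topological)
    ultimately show ?thesis by simp
  qed simp
qed

text \<open>The relatively open sets are extended to open sets of the ambient space before a finite
  subcover is taken. Enumerating it by \<open>{..<n}\<close> matches the indexing of
  \<open>weight_simplex n\<close>.\<close>

lemma compact_finite_indexed_cover:
  assumes "compact D" and "D \<subseteq> X"
    and "\<And>y. y \<in> Y \<Longrightarrow> openin (top_of_set X) (U y)" and "D \<subseteq> (\<Union>y\<in>Y. U y)"
  obtains n :: nat and y where "y ` {..<n} \<subseteq> Y" "D \<subseteq> (\<Union>i<n. U (y i))"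
proof -
  obtain T where T: "\<And>y. y \<in> Y \<Longrightarrow> open (T y) \<and> U y = X \<inter> T y"
    using assms(3) unfolding openin_open by metis
  have "D \<subseteq> (\<Union>y\<in>Y. T y)" using assms(4) T by blast
  then obtain F where F: "F \<subseteq> Y" "finite F" "D \<subseteq> (\<Union>y\<in>F. T y)"
    by (rule compactE_image[OF \<open>compact D\<close>, of Y T, rotated]) (use T in auto)
  obtain n :: nat and y where y: "F = y ` {..<n}"
    using finite_imp_nat_seg_image_inj_on[OF \<open>finite F\<close>] by (auto simp: lessThan_def)
  have "D \<subseteq> (\<Union>i<n. U (y i))"
  proof
    fix x assume "x \<in> D"
    then obtain z where "z \<in> F" "x \<in> U z" using F T assms(2) by blast
    then show "x \<in> (\<Union>i<n. U (y i))" by (auto simp: y)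
  qed
  then show thesis
    using that F(1) unfolding y by blast
qed

section \<open>The intersection theorem\<close>

text \<open>The covers are crossed: each hull is covered by sections at the points that span the
  other, so the two selections compose. Working with weights rather than points allows affinely
  dependent \<open>x j\<close> and \<open>y i\<close>.\<close>

lemma relations_intersect_of_finite_covers:
  fixes x :: "nat \<Rightarrow> 'a::topological_real_vector" and y :: "nat \<Rightarrow> 'b::topological_real_vector"
  assumes A: "A \<subseteq> X \<times> Y" "\<And>x. x \<in> X \<Longrightarrow> convex (A `` {x})"
    "\<And>y. y \<in> Y \<Longrightarrow> openin (top_of_set X) (A\<inverse> `` {y})"
    and B: "B \<subseteq> X \<times> Y" "\<And>y. y \<in> Y \<Longrightarrow> convex (B\<inverse> `` {y})"
    "\<And>x. x \<in> X \<Longrightarrow> openin (top_of_set Y) (B `` {x})"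
    and x: "x ` {..<m} \<subseteq> X" and y: "y ` {..<n} \<subseteq> Y" and "0 < m" "convex X" "convex Y"
    and cover_x: "convex hull (x ` {..<m}) \<subseteq> (\<Union>i<n. A\<inverse> `` {y i})"
    and cover_y: "convex hull (y ` {..<n}) \<subseteq> (\<Union>j<m. B `` {x j})"
  shows "A \<inter> B \<noteq> {}"
proof -
  define \<phi> where "\<phi> s = (\<Sum>j<m. s j *\<^sub>R x j)" for s :: "nat \<Rightarrow> real"
  define \<psi> where "\<psi> t = (\<Sum>i<n. t i *\<^sub>R y i)" for t :: "nat \<Rightarrow> real"
  have \<phi>: "\<phi> s \<in> convex hull (x ` {..<m})" if "s \<in> weight_simplex m" for s
    unfolding \<phi>_def using that by (intro weighted_sum_in_convex hull_inc) (auto dest: weight_simplex_support)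
  have \<psi>: "\<psi> t \<in> convex hull (y ` {..<n})" if "t \<in> weight_simplex n" for t
    unfolding \<psi>_def using that by (intro weighted_sum_in_convex hull_inc) (auto dest: weight_simplex_support)
  have \<phi>X: "\<phi> s \<in> X" if "s \<in> weight_simplex m" for s
    using \<phi>[OF that] hull_minimal[OF x, of convex] \<open>convex X\<close> by blast
  have \<psi>Y: "\<psi> t \<in> Y" if "t \<in> weight_simplex n" for t
    using \<psi>[OF that] hull_minimal[OF y, of convex] \<open>convex Y\<close> by blast
  have openA: "openin (top_of_set (weight_simplex m)) {s \<in> weight_simplex m. y i \<in> A `` {\<phi> s}}"
    if "i < n" for i
  proof -
    have "openin (top_of_set (weight_simplex m)) (weight_simplex m \<inter> \<phi> -` (A\<inverse> `` {y i}))"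
      by (rule continuous_openin_preimage[of _ _ X])
        (use A(3) y that \<phi>X in \<open>auto simp: \<phi>_def intro: continuous_on_weighted_sum\<close>)
    then show ?thesis by (simp add: Int_def vimage_def)
  qed
  have openB: "openin (top_of_set (weight_simplex n)) {t \<in> weight_simplex n. x j \<in> B\<inverse> `` {\<psi> t}}"
    if "j < m" for j
  proof -
    have "openin (top_of_set (weight_simplex n)) (weight_simplex n \<inter> \<psi> -` (B `` {x j}))"
      by (rule continuous_openin_preimage[of _ _ Y])
        (use B(3) x that \<psi>Y in \<open>auto simp: \<psi>_def intro: continuous_on_weighted_sum\<close>)
    then show ?thesis by (simp add: Int_def vimage_def)
  qed
  have "convex (A `` {\<phi> s})" "\<exists>i<n. y i \<in> A `` {\<phi> s}" if "s \<in> weight_simplex m" for s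
    using A(2) \<phi>X[OF that] \<phi>[OF that] cover_x by auto
  from continuous_selection[OF openA this]
  obtain p where p: "continuous_on (weight_simplex m) p" "p ` weight_simplex m \<subseteq> weight_simplex n"
    "\<And>s. s \<in> weight_simplex m \<Longrightarrow> \<psi> (p s) \<in> A `` {\<phi> s}"
    unfolding \<psi>_def by metis
  have "convex (B\<inverse> `` {\<psi> t})" "\<exists>j<m. x j \<in> B\<inverse> `` {\<psi> t}" if "t \<in> weight_simplex n" for t
    using B(2) \<psi>Y[OF that] \<psi>[OF that] cover_y by auto
  from continuous_selection[OF openB this]
  obtain q where q: "continuous_on (weight_simplex n) q" "q ` weight_simplex n \<subseteq> weight_simplex m"
    "\<And>t. t \<in> weight_simplex n \<Longrightarrow> \<phi> (q t) \<in> B\<inverse> `` {\<psi> t}"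
    unfolding \<phi>_def by metis
  have "continuous_on (weight_simplex m) (q \<circ> p)"
    by (rule continuous_on_compose[OF p(1) continuous_on_subset[OF q(1) p(2)]])
  moreover have "(q \<circ> p) ` weight_simplex m \<subseteq> weight_simplex m"
    using p(2) q(2) by fastforce
  ultimately obtain s where s: "s \<in> weight_simplex m" "q (p s) = s"
    using brouwer_weight_simplex[OF \<open>0 < m\<close>] by (metis comp_apply)
  \<comment> \<open>\<open>p\<close> puts \<open>(\<phi> s, \<psi> (p s))\<close> in
    \<open>A\<close>, and \<open>q\<close> puts \<open>(\<phi> (q (p s)), \<psi> (p s))\<close> in
    \<open>B\<close>; at a fixed point these pairs coincide.\<close>
  then have "(\<phi> s, \<psi> (p s)) \<in> A" using p(3) by blast
  moreover have "(\<phi> s, \<psi> (p s)) \<in> B" using q(3)[of "p s"] p(2) s by auto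
  ultimately show ?thesis by blast
qed

theorem theorem12:
  fixes X :: "'a::{topological_real_vector,t2_space} set"
    and Y :: "'b::{topological_real_vector,t2_space} set"
    and A B :: "('a \<times> 'b) set"
  assumes "X \<noteq> {}" and "convex X"
    and "Y \<noteq> {}" and "convex Y"
    and "A \<in> von_neumann_relations X Y"
    and "B \<in> inverse_von_neumann_relations X Y"
    and "compact Y \<or> compact X \<or>
      (\<exists>K C. K \<subseteq> X \<and> compact K \<and> C \<subseteq> Y \<and> compact C \<and> convex C \<and>
        (\<forall>x \<in> X - K. A `` {x} \<inter> C \<noteq> {}))"
  shows "A \<inter> B \<noteq> {}"
proof -
  have A: "A \<subseteq> X \<times> Y" "\<And>x. x \<in> X \<Longrightarrow> convex (A `` {x})" "\<And>x. x \<in> X \<Longrightarrow> A `` {x} \<noteq> {}"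
    "\<And>y. y \<in> Y \<Longrightarrow> openin (top_of_set X) (A\<inverse> `` {y})"
    using assms(5) by (auto simp: von_neumann_relations_def)
  have B: "B \<subseteq> X \<times> Y" "\<And>y. y \<in> Y \<Longrightarrow> convex (B\<inverse> `` {y})" "\<And>y. y \<in> Y \<Longrightarrow> B\<inverse> `` {y} \<noteq> {}"
    "\<And>x. x \<in> X \<Longrightarrow> openin (top_of_set Y) (B `` {x})"
    using assms(6) by (auto simp: inverse_von_neumann_relations_def von_neumann_relations_def)
  obtain K C where K: "K \<subseteq> X" "compact K" and C: "C \<subseteq> Y" "compact C" "convex C"
    and KC: "\<And>x. x \<in> X - K \<Longrightarrow> A `` {x} \<inter> C \<noteq> {}"
  proof -
    consider "compact Y" | "compact X" | "\<exists>K C. K \<subseteq> X \<and> compact K \<and> C \<subseteq> Y \<and> compact C \<and> convex C \<and>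
        (\<forall>x \<in> X - K. A `` {x} \<inter> C \<noteq> {})"
      using assms(7) by blast
    then show thesis
    proof cases
      case 1
      have "A `` {x} \<inter> Y \<noteq> {}" if "x \<in> X" for x
        using A(1) A(3)[OF that] by blast
      then show ?thesis by (intro that[of "{}" Y]) (use 1 \<open>convex Y\<close> in auto)
    next
      case 2
      show ?thesis by (rule that[of X "{}"]) (use 2 in auto)
    qed (use that in blast)
  qed
  have cover: "K \<subseteq> (\<Union>y\<in>Y. A\<inverse> `` {y})" using A(1,3) K(1) by fast
  obtain n0 :: nat and y0
    where y0: "y0 ` {..<n0} \<subseteq> Y" "K \<subseteq> (\<Union>i<n0. A\<inverse> `` {y0 i})"
    by (rule compact_finite_indexed_cover[OF K(2,1) A(4) cover])
  define D where "D = convex hull (C \<union> y0 ` {..<n0})"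
  have "compact D" unfolding D_def by (rule compact_convex_hull_Un_finite) (use C in auto)
  have "D \<subseteq> Y" unfolding D_def
    by (rule hull_minimal) (use C y0(1) \<open>convex Y\<close> in auto)
  \<comment> \<open>For \<open>x\<close> outside \<open>K\<close> the section already meets
    \<open>C\<close>; for \<open>x\<close> in \<open>K\<close> it contains some
    \<open>y0 i\<close>.\<close>
  have D: "A `` {x} \<inter> D \<noteq> {}" if "x \<in> X" for x
  proof -
    have "C \<union> y0 ` {..<n0} \<subseteq> D" unfolding D_def by (rule hull_subset)
    then show ?thesis using KC[of x] y0(2) that by (cases "x \<in> K") blast+
  qed
  \<comment> \<open>The \<open>x j\<close> are chosen first, to serve all of \<open>D\<close>. Hence
    they remain adequate for the hull of any points of \<open>D\<close> chosen later.\<close>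
  have cover: "D \<subseteq> (\<Union>x\<in>X. B `` {x})" using B(1,3) \<open>D \<subseteq> Y\<close> by fast
  obtain m :: nat and x where x: "x ` {..<m} \<subseteq> X" "D \<subseteq> (\<Union>j<m. B `` {x j})"
    by (rule compact_finite_indexed_cover[OF \<open>compact D\<close> \<open>D \<subseteq> Y\<close> B(4) cover])
  define E where "E = convex hull (x ` {..<m})"
  have "compact E" unfolding E_def
    using compact_convex_hull_Un_finite[of "x ` {..<m}" "{}"] by simp
  have "E \<subseteq> X" unfolding E_def
    by (rule hull_minimal) (use x(1) \<open>convex X\<close> in auto)
  have cover: "E \<subseteq> (\<Union>y\<in>D. A\<inverse> `` {y})" using D \<open>E \<subseteq> X\<close> by fast
  obtain n :: nat and y where y: "y ` {..<n} \<subseteq> D" "E \<subseteq> (\<Union>i<n. A\<inverse> `` {y i})"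
    by (rule compact_finite_indexed_cover[OF \<open>compact E\<close> \<open>E \<subseteq> X\<close> A(4)[OF subsetD[OF \<open>D \<subseteq> Y\<close>]] cover])
  have "convex hull (y ` {..<n}) \<subseteq> D"
    by (rule hull_minimal) (use y(1) in \<open>auto simp: D_def\<close>)
  have "D \<noteq> {}" using D \<open>X \<noteq> {}\<close> by blast
  \<comment> \<open>For \<open>m = 0\<close> the nonempty set \<open>D\<close> would be covered by
    an empty union.\<close>
  then have "0 < m" using x(2) by (cases m) auto
  show ?thesis
  proof (rule relations_intersect_of_finite_covers[OF A(1,2,4) B(1,2,4)])
    show "x ` {..<m} \<subseteq> X" "y ` {..<n} \<subseteq> Y" using x(1) y(1) \<open>D \<subseteq> Y\<close> by auto
    show "convex hull (x ` {..<m}) \<subseteq> (\<Union>i<n. A\<inverse> `` {y i})" using y(2) by (simp add: E_def)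
    show "convex hull (y ` {..<n}) \<subseteq> (\<Union>j<m. B `` {x j})"
      using \<open>convex hull (y ` {..<n}) \<subseteq> D\<close> x(2) by blast
  qed (use \<open>0 < m\<close> \<open>convex X\<close> \<open>convex Y\<close> in auto)
qed

end
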